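(* Let $H\in(\tfrac12,1)$, $a\in\mathbb{R}$ and $\alpha>2-2H$. Let $(\xi_i)_{i\ge1}$ be i.i.d. standard normal random variables. For each integer $N\ge1$, let $f_j=f_j^{(N)}$ and $g_j=g_j^{(N)}$ ($j\ge0$) be the random variables defined in the context, and let the observations be given by $Y_0=0$ and $$Y_{j+1}=Y_j+\frac aN+f_j+g_j\,\xi_{j+1},\qquad j=0,\dots,N^\alpha-1 .$$ Consider the estimator (almost surely well defined, since almost surely $g_j\neq0$ for all $j$) $$\hat a_N=\frac{N\sum_{j=0}^{N^\alpha-1}\dfrac{Y_{j+1}-Y_j-f_j}{g_j^2}}{\sum_{j=0}^{N^\alpha-1}\dfrac1{g_j^2}} .$$ Then $\hat a_N$ is strongly consistent, i.e. $\hat a_N\to a$ almost surely as $N\to\infty$.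
   Context: $N^\alpha$ denotes the number of observations and is understood as its integer part $\lfloor N^\alpha\rfloor$ when it is not an integer. The same sequence $(\xi_i)_{i\ge1}$ is used for all $N$. Kernel. For $H'\in(\tfrac12,1)$ and $t>s>0$ put $$K^{H'}(t,s)=c_{H'}\,s^{\frac12-H'}\int_s^t(u-s)^{H'-\frac32}u^{H'-\frac12}\,du,\qquad c_{H'}=\left(\frac{H'(2H'-1)}{\beta(2-2H',H'-\frac12)}\right)^{1/2},$$ where $\beta(\cdot,\cdot)$ is the beta function, so that $\frac{\partial K^{H'}}{\partial t}(t,s)=c_{H'}\left(\frac st\right)^{\frac12-H'}(t-s)^{H'-\frac32}$. For $H\in(\tfrac12,1)$ let $H'=\frac{H+1}{2}$, $d(H)=\frac1{H+1}\left(\frac{H}{2(2H-1)}\right)^{-1/2}$ and $$F(t,y_1,y_2)=d(H)\,1_{[0,t]}(y_1)1_{[0,t]}(y_2)\int_{y_1\vee y_2}^t\frac{\partial K^{H'}}{\partial u}(u,y_1)\,\frac{\partial K^{H'}}{\partial u}(u,y_2)\,du .$$ Coefficients. For each $N\ge1$: $f_0=0$, $f_1=-\xi_1/N^H$, and for $j\ge2$ $$f_j=N\sum_{i,k=1;\,i\ne k}^{j}\left(\int_{\frac{i-1}N}^{\frac iN}\int_{\frac{k-1}N}^{\frac kN}\Big(F\big(\tfrac{j+1}N,u,v\big)-F\big(\tfrac jN,u,v\big)\Big)dv\,du\right)\xi_i\xi_k ;$$ $g_0=1/N^H$, and for $j\ge1$ $$g_j=2N\sum_{i=1}^{j}\left(\int_{\frac{i-1}N}^{\frac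 iN}\int_{\frac jN}^{\frac{j+1}N}F\big(\tfrac{j+1}N,u,v\big)\,dv\,du\right)\xi_i .$$ *)

theory Defs
  imports "HOL-Probability.Probability"
begin

definition vol_const :: "real \<Rightarrow> real" where
  "vol_const h = (h * (2 * h - 1) / Beta (2 - 2 * h) (h - 1 / 2)) powr (1 / 2)"

(* Meaningful for 1/2 < h < 1 and t > s > 0 only; elsewhere the value is irrelevant. *)
definition vol_kernel :: "real \<Rightarrow> real \<Rightarrow> real \<Rightarrow> real" where
  "vol_kernel h t s =
     vol_const h * s powr (1 / 2 - h) *
     (LBINT u:{s..t}. (u - s) powr (h - 3 / 2) * u powr (h - 1 / 2))"

definition vol_kernel_deriv :: "real \<Rightarrow> real \<Rightarrow> real \<Rightarrow> real" where
  "vol_kernel_deriv h t s = deriv (\<lambda>x. vol_kernel h x s) t"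

lemma vol_kernel_deriv_eq:
  assumes h: "1 / 2 < h" "h < 1" and st: "0 < s" "s < t"
  shows "vol_kernel_deriv h t s =
    vol_const h * (s / t) powr (1 / 2 - h) * (t - s) powr (h - 3 / 2)"
proof -
  define f where "f = (\<lambda>u. (u - s) powr (h - 3 / 2) * u powr (h - 1 / 2))"
  define p where "p = (\<lambda>u. (u - s) powr (h - 3 / 2))"
  define b where "b = t + 1"
  have "(\<lambda>u. u powr (h - 3 / 2)) integrable_on {0..b - s}"
    by (rule integrable_on_powr_from_0) (use h st in \<open>auto simp: b_def\<close>)
  from integrable_shift_real_ivl[OF this, of "- s"] have "p integrable_on {s..b}"
    by (simp add: p_def)
  then have "p absolutely_integrable_on {s..b}"
    by (rule nonnegative_absolutely_integrable_1) (simp add: p_def)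
  moreover have "(\<lambda>u. indicator {s..b} u *\<^sub>R p u) \<in> borel_measurable lborel"
    unfolding p_def by measurable
  ultimately have "set_integrable lborel {s..b} p"
    unfolding set_integrable_def by (subst (asm) integrable_completion) auto
  then have p: "set_integrable lborel {s..b} (\<lambda>u. b powr (h - 1 / 2) * p u)"
    by simp
  have f: "set_integrable lborel {s..b} f"
  proof (rule set_integrable_bound[OF p])
    show "set_borel_measurable lborel {s..b} f"
      unfolding set_borel_measurable_def f_def by measurable
    have "norm (f u) \<le> norm (b powr (h - 1 / 2) * p u)" if "u \<in> {s..b}" for u
    proof -
      have "u powr (h - 1 / 2) \<le> b powr (h - 1 / 2)"
        using that h st by (intro powr_mono2) auto
      then have "p u * u powr (h - 1 / 2) \<le> p u * b powr (h - 1 / 2)"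
        by (rule mult_left_mono) (simp add: p_def)
      then show ?thesis
        by (simp add: f_def p_def abs_mult mult.commute)
    qed
    then show "AE u in lborel. u \<in> {s..b} \<longrightarrow> norm (f u) \<le> norm (b powr (h - 1 / 2) * p u)"
      by simp
  qed
  have eq: "vol_const h * s powr (1 / 2 - h) * integral {s..x} f = vol_kernel h x s"
    if "x \<in> {s<..<b}" for x
  proof -
    have "set_integrable lborel {s..x} f"
      by (rule set_integrable_subset[OF f]) (use that in auto)
    from set_borel_integral_eq_integral(2)[OF this] show ?thesis
      by (simp add: vol_kernel_def f_def)
  qed
  have "continuous (at t within {s..b} - {}) f"
    unfolding f_def using st by (intro continuous_intros) auto
  then have "((\<lambda>x. integral {s..x} f) has_vector_derivative f t) (at t within {s..b} - {})"
    by (intro integral_has_vector_derivative_continuous_at set_borel_integral_eq_integral(1)[OF f])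
      (use st in \<open>auto simp: b_def\<close>)
  then have "((\<lambda>x. integral {s..x} f) has_real_derivative f t) (at t within {s<..<b})"
    by (auto simp: has_real_derivative_iff_has_vector_derivative
        intro: has_vector_derivative_within_subset)
  then have "((\<lambda>x. integral {s..x} f) has_real_derivative f t) (at t)"
    using st by (subst (asm) at_within_open) (auto simp: b_def)
  then have "((\<lambda>x. vol_const h * s powr (1 / 2 - h) * integral {s..x} f) has_real_derivative
      vol_const h * s powr (1 / 2 - h) * f t) (at t)"
    by (rule DERIV_cmult)
  then have "((\<lambda>x. vol_kernel h x s) has_real_derivative
      vol_const h * s powr (1 / 2 - h) * f t) (at t)"
    by (rule has_field_derivative_transform_within_open[where S = "{s<..<b}"])
      (use st eq in \<open>auto simp: b_def\<close>)
  then have "vol_kernel_deriv h t s = vol_const h * s powr (1 / 2 - h) * f t"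
    unfolding vol_kernel_deriv_def by (rule DERIV_imp_deriv)
  moreover have "s powr (1 / 2 - h) * t powr (h - 1 / 2) = (s / t) powr (1 / 2 - h)"
    using powr_minus_divide[of t "1 / 2 - h"] st by (simp add: powr_divide)
  ultimately show ?thesis
    by (simp only: f_def mult.assoc mult.left_commute[of "(t - s) powr (h - 3 / 2)"]
        mult.commute[of "(t - s) powr (h - 3 / 2)"])
      (simp flip: mult.assoc)
qed

definition rosenblatt_const :: "real \<Rightarrow> real" where
  "rosenblatt_const H = 1 / (H + 1) * (H / (2 * (2 * H - 1))) powr (- 1 / 2)"

(* The inner integral diverges for y1 = y2 < t (and is then 0 by the library convention); the
   diagonal and the axes y1 = 0, y2 = 0 are null sets and do not contribute below. *)
definition rosenblatt_kernel :: "real \<Rightarrow> real \<Rightarrow> real \<Rightarrow> real \<Rightarrow> real" where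
  "rosenblatt_kernel H t y1 y2 =
     rosenblatt_const H * indicator {0..t} y1 * indicator {0..t} y2 *
     (LBINT u:{max y1 y2..t}.
        vol_kernel_deriv ((H + 1) / 2) u y1 * vol_kernel_deriv ((H + 1) / 2) u y2)"

(* In the following, x i stands for the realisation of the i-th noise variable, i >= 1;
   x 0 is never used. *)

definition coeff_f :: "real \<Rightarrow> nat \<Rightarrow> (nat \<Rightarrow> real) \<Rightarrow> nat \<Rightarrow> real" where
  "coeff_f H N x j =
     (if j = 0 then 0
      else if j = 1 then - x 1 / real N powr H
      else real N * (\<Sum>i\<in>{1..j}. \<Sum>k\<in>{1..j} - {i}.
        (LBINT u:{(real i - 1) / real N..real i / real N}.
          LBINT v:{(real k - 1) / real N..real k / real N}.
            rosenblatt_kernel H ((real j + 1) / real N) u v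
              - rosenblatt_kernel H (real j / real N) u v) * x i * x k))"

definition coeff_g :: "real \<Rightarrow> nat \<Rightarrow> (nat \<Rightarrow> real) \<Rightarrow> nat \<Rightarrow> real" where
  "coeff_g H N x j =
     (if j = 0 then 1 / real N powr H
      else 2 * real N * (\<Sum>i\<in>{1..j}.
        (LBINT u:{(real i - 1) / real N..real i / real N}.
          LBINT v:{real j / real N..(real j + 1) / real N}.
            rosenblatt_kernel H ((real j + 1) / real N) u v) * x i))"

primrec observation :: "real \<Rightarrow> real \<Rightarrow> nat \<Rightarrow> (nat \<Rightarrow> real) \<Rightarrow> nat \<Rightarrow> real" where
  "observation H a N x 0 = 0"
| "observation H a N x (Suc j) =
     observation H a N x j + a / real N + coeff_f H N x j + coeff_g H N x j * x (Suc j)"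

definition num_obs :: "real \<Rightarrow> nat \<Rightarrow> nat" where
  "num_obs \<alpha> N = nat \<lfloor>real N powr \<alpha>\<rfloor>"

(* Y is the observed path; the drift parameter enters only through Y. *)
definition drift_estimator ::
  "real \<Rightarrow> real \<Rightarrow> nat \<Rightarrow> (nat \<Rightarrow> real) \<Rightarrow> (nat \<Rightarrow> real) \<Rightarrow> real" where
  "drift_estimator H \<alpha> N x Y =
     real N * (\<Sum>j<num_obs \<alpha> N. (Y (Suc j) - Y j - coeff_f H N x j) / (coeff_g H N x j)\<^sup>2)
     / (\<Sum>j<num_obs \<alpha> N. 1 / (coeff_g H N x j)\<^sup>2)"

end

theory Submission
  imports Defs "HOL-Real_Asymp.Real_Asymp"
begin

text \<open>The kernel \<open>F\<close> is homogeneous of degree \<open>H - 1\<close>, so \<open>g\<^sub>j = \<gamma>\<^sub>j / N\<^sup>H\<close> with \<open>\<gamma>\<^sub>j\<close> independent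
  of \<open>N\<close>, and the estimation error is \<open>N\<^bsup>1 - H\<^esup> S / A\<close> where \<open>S = \<Sum>j<n. \<xi>\<^sub>j\<^sub>+\<^sub>1 / \<gamma>\<^sub>j\<close>,
  \<open>A = \<Sum>j<n. 1 / \<gamma>\<^sub>j\<^sup>2\<close> and \<open>n = \<lfloor>N\<^sup>\<alpha>\<rfloor>\<close>. As \<open>1 / \<gamma>\<^sub>j\<close> has no second moment, \<open>S\<close> is controlled by
  an exponential instead of a quadratic bound: \<open>\<gamma>\<^sub>j\<close> is a function of \<open>\<xi>\<^sub>1, \<dots>, \<xi>\<^sub>j\<close>, hence
  \<open>exp (\<plusminus> L S - L\<^sup>2 A / 2)\<close> has expectation 1 for each constant \<open>L\<close>. Almost surely these variables
  are therefore \<open>O(N\<^sup>2)\<close> along any choice \<open>L = L\<^sub>N\<close>, which gives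
  \<open>\<bar>S\<bar> / A \<le> L / 2 + O(log N) / (L A)\<close>.

  The \<open>\<gamma>\<^sub>j\<close> are centred Gaussian with bounded variances, so almost surely
  \<open>\<Sum>j<n. \<gamma>\<^sub>j\<^sup>2 = O(n\<^bsup>1 + \<delta>\<^esup>)\<close>, and Cauchy--Schwarz gives \<open>A \<ge> c n\<^bsup>1 - \<delta>\<^esup>\<close> with some \<open>c > 0\<close>. Since
  \<open>\<alpha> > 2 - 2 H\<close>, the choice \<open>L = N\<^bsup>- (1 - H + e)\<^esup>\<close> with small \<open>e\<close> and \<open>\<delta>\<close> makes the error vanish.\<close>

subsection \<open>Integrals over compact intervals\<close>

text \<open>Endpoints form a null set. This matters because the kernel formulas below are available
  only under strict inequalities between the time arguments.\<close>

lemma LBINT_cong_interior: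
  fixes f g :: "real \<Rightarrow> real"
  assumes "\<And>x. x \<in> {a<..<b} \<Longrightarrow> f x = g x"
  shows "(LBINT x:{a..b}. f x) = (LBINT x:{a..b}. g x)"
  unfolding set_lebesgue_integral_def
  by (rule integral_discrete_difference[where X = "{a, b}"])
    (use assms in \<open>auto simp: indicator_def\<close>)

lemma LBINT_rescale:
  fixes f :: "real \<Rightarrow> real"
  assumes "0 < c"
  shows "(LBINT x:{a / c..b / c}. f x) = (LBINT x:{a..b}. f (x / c)) / c"
proof -
  have "(LBINT x:{a / c..b / c}. f x)
      = (1 / c) * (\<integral>x. indicator {a / c..b / c} (x / c) *\<^sub>R f (x / c) \<partial>lborel)"
    unfolding set_lebesgue_integral_def
    using lborel_integral_real_affine[of "1 / c" "\<lambda>x. indicator {a / c..b / c} x *\<^sub>R f x" 0] assms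
    by simp
  also have "(\<lambda>x. indicator {a / c..b / c} (x / c) *\<^sub>R f (x / c))
      = (\<lambda>x. indicator {a..b} x *\<^sub>R f (x / c))"
    using assms by (auto simp: indicator_def fun_eq_iff divide_right_mono field_simps)
  finally show ?thesis
    by (simp add: set_lebesgue_integral_def)
qed

text \<open>Nonnegativity of \<open>g\<close> covers the case of a non-integrable \<open>f\<close>,
  whose integral is 0 by convention.\<close>

lemma LBINT_mono_interior:
  fixes f g :: "real \<Rightarrow> real"
  assumes g: "set_integrable lborel {a..b} g"
    and le: "\<And>x. x \<in> {a<..<b} \<Longrightarrow> f x \<le> g x"
    and nn: "\<And>x. x \<in> {a<..<b} \<Longrightarrow> 0 \<le> g x"
  shows "(LBINT x:{a..b}. f x) \<le> (LBINT x:{a..b}. g x)"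
proof -
  have AE: "AE x in lborel. x \<noteq> a \<and> x \<noteq> b"
    using AE_lborel_singleton[of a] AE_lborel_singleton[of b] by auto
  show ?thesis
    unfolding set_lebesgue_integral_def
  proof (rule integral_mono_AE')
    show "integrable lborel (\<lambda>x. indicator {a..b} x *\<^sub>R g x)"
      using g by (simp add: set_integrable_def)
    show "AE x in lborel. indicator {a..b} x *\<^sub>R f x \<le> indicator {a..b} x *\<^sub>R g x"
      using AE by eventually_elim (auto simp: indicator_def intro: le)
    show "AE x in lborel. 0 \<le> indicator {a..b} x *\<^sub>R g x"
      using AE by eventually_elim (auto simp: indicator_def intro: nn)
  qed
qed

text \<open>A vanishing integral of a nonnegative function would force the integrand to be 0 almost
  everywhere, making the nonempty open interval a null set.\<close>

lemma LBINT_pos_interior: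
  fixes f :: "real \<Rightarrow> real"
  assumes f: "set_integrable lborel {a..b} f" and ab: "a < b"
    and pos: "\<And>x. x \<in> {a<..<b} \<Longrightarrow> 0 < f x"
  shows "0 < (LBINT x:{a..b}. f x)"
proof -
  have AE: "AE x in lborel. x \<noteq> a \<and> x \<noteq> b"
    using AE_lborel_singleton[of a] AE_lborel_singleton[of b] by auto
  have nn: "AE x in lborel. 0 \<le> indicator {a..b} x *\<^sub>R f x"
    using AE by eventually_elim (auto simp: indicator_def intro!: less_imp_le[OF pos])
  have int: "integrable lborel (\<lambda>x. indicator {a..b} x *\<^sub>R f x)"
    using f by (simp add: set_integrable_def)
  have "\<not> (AE x in lborel. indicator {a..b} x *\<^sub>R f x = 0)"
  proof
    assume "AE x in lborel. indicator {a..b} x *\<^sub>R f x = 0"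
    then have "AE x in lborel. x \<notin> {a<..<b}"
      by eventually_elim (use pos in \<open>force simp: indicator_def\<close>)
    then have "emeasure lborel {a<..<b} = 0"
      by (subst (asm) AE_iff_measurable[where N = "{a<..<b}"]) auto
    with ab show False
      by simp
  qed
  with integral_nonneg_eq_0_iff_AE[OF int nn] integral_nonneg_AE[OF nn] show ?thesis
    unfolding set_lebesgue_integral_def by linarith
qed

lemma
  fixes a b e :: real
  assumes e: "-1 < e" and ab: "a \<le> b"
  shows set_integrable_powr_shift: "set_integrable lborel {a..b} (\<lambda>x. (x - a) powr e)"
    and LBINT_powr_shift: "(LBINT x:{a..b}. (x - a) powr e) = (b - a) powr (e + 1) / (e + 1)"
proof -
  have hi: "((\<lambda>x. (x - a) powr e) has_integral ((b - a) powr (e + 1) / (e + 1))) {a..b}"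
    using has_integral_shift_real_ivl[OF has_integral_powr_from_0[OF e, of "b - a"], of "- a"] ab
    by simp
  then have "(\<lambda>x. (x - a) powr e) absolutely_integrable_on {a..b}"
    by (intro nonnegative_absolutely_integrable_1) (auto simp: integrable_on_def)
  \<comment> \<open>Absolute gauge integrability refers to the completed measure; Borel
    measurability transfers it back to \<open>lborel\<close>.\<close>
  moreover have "(\<lambda>x. indicator {a..b} x *\<^sub>R (x - a) powr e) \<in> borel_measurable lborel"
    by measurable
  ultimately show *: "set_integrable lborel {a..b} (\<lambda>x. (x - a) powr e)"
    unfolding set_integrable_def by (subst (asm) integrable_completion) auto
  show "(LBINT x:{a..b}. (x - a) powr e) = (b - a) powr (e + 1) / (e + 1)"
    using set_borel_integral_eq_integral(2)[OF *] hi by (simp add: integral_unique)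
qed

subsection \<open>Self-similarity of the kernel\<close>

text \<open>The product of the two kernel derivatives without their constants: for h = (H + 1) / 2
  the exponents 1/2 - h and h - 3/2 become - H/2 and H/2 - 1.\<close>

definition volterra_product :: "real \<Rightarrow> real \<Rightarrow> real \<Rightarrow> real \<Rightarrow> real" where
  "volterra_product H u v w =
     (u / w) powr (- H / 2) * (w - u) powr (H / 2 - 1) *
     ((v / w) powr (- H / 2) * (w - v) powr (H / 2 - 1))"

definition rosenblatt_factor :: "real \<Rightarrow> real" where
  "rosenblatt_factor H = rosenblatt_const H * (vol_const ((H + 1) / 2))\<^sup>2"

lemma rosenblatt_factor_pos:
  assumes "1 / 2 < H" "H < 1"
  shows "0 < rosenblatt_factor H"
proof -
  have "0 < Beta (2 - 2 * ((H + 1) / 2)) ((H + 1) / 2 - 1 / 2)"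
    using assms unfolding Beta_def
    by (intro divide_pos_pos mult_pos_pos Gamma_real_pos) (auto simp: field_simps)
  then have "vol_const ((H + 1) / 2) \<noteq> 0"
    using assms by (simp add: vol_const_def)
  then show ?thesis
    using assms by (simp add: rosenblatt_factor_def rosenblatt_const_def)
qed

text \<open>The ordered case u < v is the relevant one: in g_j the first variable ranges over cells
  to the left of the cell of the second. Then the maximum is v, and both derivatives have their
  closed form for w > v.\<close>

lemma rosenblatt_kernel_eq:
  assumes H: "1 / 2 < H" "H < 1" and uv: "0 < u" "u < v" "v \<le> T"
  shows "rosenblatt_kernel H T u v = rosenblatt_factor H * (LBINT w:{v..T}. volterra_product H u v w)"
proof -
  have "(LBINT w:{v..T}. vol_kernel_deriv ((H + 1) / 2) w u * vol_kernel_deriv ((H + 1) / 2) w v)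
     = (LBINT w:{v..T}. (vol_const ((H + 1) / 2))\<^sup>2 * volterra_product H u v w)"
  proof (rule LBINT_cong_interior)
    fix w assume w: "w \<in> {v<..<T}"
    have e: "1 / 2 - (H + 1) / 2 = - H / 2" "(H + 1) / 2 - 3 / 2 = H / 2 - 1"
      by (simp_all add: field_simps)
    have "vol_kernel_deriv ((H + 1) / 2) w s =
        vol_const ((H + 1) / 2) * (s / w) powr (- H / 2) * (w - s) powr (H / 2 - 1)"
      if "0 < s" "s < w" for s
      using vol_kernel_deriv_eq[of "(H + 1) / 2" s w] that H unfolding e by simp
    then show "vol_kernel_deriv ((H + 1) / 2) w u * vol_kernel_deriv ((H + 1) / 2) w v =
        (vol_const ((H + 1) / 2))\<^sup>2 * volterra_product H u v w"
      using uv w by (simp add: volterra_product_def power2_eq_square)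
  qed
  then show ?thesis
    using uv by (simp add: rosenblatt_kernel_def rosenblatt_factor_def)
qed

text \<open>The quotients are scale invariant, and each of the two differences contributes a factor
  c^(1 - H/2).\<close>

lemma volterra_product_rescale:
  assumes "0 < c" "0 < u" "u < v" "v < w"
  shows "volterra_product H (u / c) (v / c) (w / c) = c powr (2 - H) * volterra_product H u v w"
proof -
  have d: "(w / c - s / c) powr (H / 2 - 1) = c powr (1 - H / 2) * (w - s) powr (H / 2 - 1)"
    if "s < w" for s
    using that assms powr_minus_divide[of c "H / 2 - 1"]
    by (simp flip: diff_divide_distrib add: powr_divide)
  have "c powr (2 - H) = c powr (1 - H / 2) * c powr (1 - H / 2)"
    by (simp flip: powr_add)
  then show ?thesis
    using assms by (simp add: volterra_product_def d)
qed

text \<open>The integrand scales with c^(2 - H), and substituting w / c in the integral costs a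
  factor 1 / c.\<close>

lemma rosenblatt_kernel_rescale:
  assumes H: "1 / 2 < H" "H < 1" and c: "0 < c" and uv: "0 < u" "u < v" "v < T"
  shows "rosenblatt_kernel H (T / c) (u / c) (v / c) = c powr (1 - H) * rosenblatt_kernel H T u v"
proof -
  have "(LBINT w:{v..T}. volterra_product H (u / c) (v / c) (w / c))
      = (LBINT w:{v..T}. c powr (2 - H) * volterra_product H u v w)"
    by (rule LBINT_cong_interior) (use c uv in \<open>simp add: volterra_product_rescale\<close>)
  moreover have "c powr (2 - H) = c * c powr (1 - H)"
    using c by (simp add: powr_mult_base)
  moreover have "v / c \<le> T / c" "u / c < v / c" "0 < u / c"
    using c uv by (auto simp: divide_right_mono divide_strict_right_mono)
  ultimately show ?thesis
    using c uv H by (simp add: rosenblatt_kernel_eq LBINT_rescale)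
qed

definition rosenblatt_coeff :: "real \<Rightarrow> nat \<Rightarrow> nat \<Rightarrow> real" where
  "rosenblatt_coeff H j i =
     (LBINT u:{real i - 1..real i}. LBINT v:{real j..real j + 1}.
        rosenblatt_kernel H (real j + 1) u v)"

text \<open>The N-free version of g_j, namely N^H g_j. The value 1 at j = 0 mirrors g_0 = 1 /
  N^H.\<close>

definition unit_coeff :: "real \<Rightarrow> (nat \<Rightarrow> real) \<Rightarrow> nat \<Rightarrow> real" where
  "unit_coeff H x j = (if j = 0 then 1 else \<Sum>i\<in>{1..j}. 2 * rosenblatt_coeff H j i * x i)"

text \<open>Rescaling both integration variables gives N^(-2), the kernel gives N^(1 - H), and the
  prefactor of g_j gives N; the product is N^(-H).\<close>

lemma coeff_g_eq:
  assumes H: "1 / 2 < H" "H < 1" and N: "1 \<le> N"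
  shows "coeff_g H N x j = unit_coeff H x j / real N powr H"
proof (cases "j = 0")
  case False
  have c: "0 < real N"
    using N by simp
  have "(LBINT u:{(real i - 1) / real N..real i / real N}.
          LBINT v:{real j / real N..(real j + 1) / real N}.
            rosenblatt_kernel H ((real j + 1) / real N) u v)
      = rosenblatt_coeff H j i / (real N * real N powr H)" if i: "i \<in> {1..j}" for i
  proof -
    have "(LBINT u:{(real i - 1) / real N..real i / real N}.
          LBINT v:{real j / real N..(real j + 1) / real N}.
            rosenblatt_kernel H ((real j + 1) / real N) u v)
      = (LBINT u:{real i - 1..real i}. LBINT v:{real j..real j + 1}.
            rosenblatt_kernel H ((real j + 1) / real N) (u / N) (v / N)) / N / N"
      by (simp only: LBINT_rescale[OF c] set_integral_divide_zero)
    also have "(LBINT u:{real i - 1..real i}. LBINT v:{real j..real j + 1}.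
            rosenblatt_kernel H ((real j + 1) / real N) (u / N) (v / N))
      = (LBINT u:{real i - 1..real i}. LBINT v:{real j..real j + 1}.
            real N powr (1 - H) * rosenblatt_kernel H (real j + 1) u v)"
      by (intro LBINT_cong_interior rosenblatt_kernel_rescale H c) (use i in auto)
    also have "\<dots> / N / N = rosenblatt_coeff H j i / (real N * real N powr H)"
      using c by (simp add: rosenblatt_coeff_def powr_diff)
    finally show ?thesis .
  qed
  then show ?thesis
    using False c by (simp add: coeff_g_def unit_coeff_def sum_distrib_left sum_divide_distrib mult.assoc)
qed (simp add: coeff_g_def unit_coeff_def)

subsection \<open>Size of the coefficients\<close>

text \<open>The bound keeps w only in the singular factor at w = v, so that it can be integrated in
  closed form. Replacing w - u by the smaller v - u is legitimate since H/2 - 1 < 0.\<close>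

lemma volterra_product_bounds:
  assumes H: "1 / 2 < H" "H < 1" and uv: "0 < u" "u < v" "v < w" "w \<le> T"
  shows "0 < volterra_product H u v w"
    and "volterra_product H u v w \<le>
      (T / u) powr (H / 2) * (T / v) powr (H / 2) * (v - u) powr (H / 2 - 1) * (w - v) powr (H / 2 - 1)"
proof -
  show "0 < volterra_product H u v w"
    using uv by (simp add: volterra_product_def)
  have flip: "(s / w) powr (- H / 2) \<le> (T / s) powr (H / 2)" if "0 < s" "s < w" for s
  proof -
    have "(s / w) powr (- H / 2) = (w / s) powr (H / 2)"
      using that powr_minus_divide[of "s / w" "H / 2"] by (simp add: powr_divide)
    also have "\<dots> \<le> (T / s) powr (H / 2)"
      using that uv H by (intro powr_mono2 divide_right_mono) auto
    finally show ?thesis .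
  qed
  have "(w - u) powr (H / 2 - 1) \<le> (v - u) powr (H / 2 - 1)"
    using uv H by (intro powr_mono2') auto
  then have "volterra_product H u v w \<le>
      (T / u) powr (H / 2) * (v - u) powr (H / 2 - 1) * ((T / v) powr (H / 2) * (w - v) powr (H / 2 - 1))"
    unfolding volterra_product_def using uv by (intro mult_mono flip) auto
  then show "volterra_product H u v w \<le>
      (T / u) powr (H / 2) * (T / v) powr (H / 2) * (v - u) powr (H / 2 - 1) * (w - v) powr (H / 2 - 1)"
    by (simp add: mult_ac)
qed

lemma volterra_product_integrable:
  assumes H: "1 / 2 < H" "H < 1" and uv: "0 < u" "u < v" "v \<le> T"
  shows "set_integrable lborel {v..T} (volterra_product H u v)"
proof (rule set_integrable_bound)
  show "set_integrable lborel {v..T} (\<lambda>w. (T / u) powr (H / 2) * (T / v) powr (H / 2) *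
      (v - u) powr (H / 2 - 1) * (w - v) powr (H / 2 - 1))"
    using H uv by (intro set_integrable_mult_right set_integrable_powr_shift) auto
  show "set_borel_measurable lborel {v..T} (volterra_product H u v)"
    unfolding set_borel_measurable_def volterra_product_def by measurable
  have "norm (volterra_product H u v w) \<le> norm ((T / u) powr (H / 2) * (T / v) powr (H / 2) *
      (v - u) powr (H / 2 - 1) * (w - v) powr (H / 2 - 1))" if "w \<in> {v..T}" for w
  \<comment> \<open>At w = v both sides are 0, because 0 raised to any power by \<open>powr\<close>
    is 0.\<close>
  proof (cases "w = v")
    case False
    then show ?thesis
      using volterra_product_bounds[OF H uv(1,2), of w T] that by simp
  qed (simp add: volterra_product_def)
  then show "AE w in lborel. w \<in> {v..T} \<longrightarrow> norm (volterra_product H u v w) \<le>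
      norm ((T / u) powr (H / 2) * (T / v) powr (H / 2) * (v - u) powr (H / 2 - 1) *
        (w - v) powr (H / 2 - 1))"
    by simp
qed

section \<open>Bounds for the kernel without its constant factor\<close>

definition volterra_integral :: "real \<Rightarrow> real \<Rightarrow> real \<Rightarrow> real \<Rightarrow> real" where
  "volterra_integral H T u v = (LBINT w:{v..T}. volterra_product H u v w)"

text \<open>Joint measurability is what makes the inner integral over v a measurable function of u.
  The moving endpoint v is first turned into a condition inside the integrand.\<close>

lemma measurable_volterra_integral [measurable]:
  "(\<lambda>p. volterra_integral H T (fst p) (snd p)) \<in> borel_measurable (borel \<Otimes>\<^sub>M borel)"
proof -
  have "(\<lambda>p. \<integral>w. (if snd p \<le> w \<and> w \<le> T then volterra_product H (fst p) (snd p) w else 0) \<partial>lborel)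
      \<in> borel_measurable (borel \<Otimes>\<^sub>M borel)"
    unfolding volterra_product_def by measurable
  also have "(\<lambda>p. \<integral>w. (if snd p \<le> w \<and> w \<le> T then volterra_product H (fst p) (snd p) w else 0) \<partial>lborel)
      = (\<lambda>p. volterra_integral H T (fst p) (snd p))"
    unfolding volterra_integral_def set_lebesgue_integral_def
    by (intro ext Bochner_Integration.integral_cong) (auto simp: indicator_def)
  finally show ?thesis .
qed

lemma volterra_integral_pos:
  assumes "1 / 2 < H" "H < 1" "0 < u" "u < v" "v < T"
  shows "0 < volterra_integral H T u v"
  unfolding volterra_integral_def
  using assms by (intro LBINT_pos_interior volterra_product_integrable volterra_product_bounds) auto

lemma volterra_integral_le:
  assumes H: "1 / 2 < H" "H < 1" and uv: "0 < u" "u < v" "v < T"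
  shows "volterra_integral H T u v \<le>
    (T / u) powr (H / 2) * (T / v) powr (H / 2) * (v - u) powr (H / 2 - 1) *
      ((T - v) powr (H / 2) / (H / 2))"
proof -
  have "volterra_integral H T u v \<le>
    (LBINT w:{v..T}. (T / u) powr (H / 2) * (T / v) powr (H / 2) *
      (v - u) powr (H / 2 - 1) * (w - v) powr (H / 2 - 1))"
    unfolding volterra_integral_def
  proof (rule LBINT_mono_interior)
    show "set_integrable lborel {v..T} (\<lambda>w. (T / u) powr (H / 2) * (T / v) powr (H / 2) *
      (v - u) powr (H / 2 - 1) * (w - v) powr (H / 2 - 1))"
      using H uv by (intro set_integrable_mult_right set_integrable_powr_shift) auto
  qed (use volterra_product_bounds[OF H uv(1,2)] in auto)
  also have "\<dots> = (T / u) powr (H / 2) * (T / v) powr (H / 2) * (v - u) powr (H / 2 - 1) *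
      ((T - v) powr (H / 2) / (H / 2))"
    using LBINT_powr_shift[of "H / 2 - 1" v T] H uv by simp
  finally show ?thesis .
qed

text \<open>On a unit interval \<open>[k, k + 1]\<close> one has \<open>x \<ge> (k + 1) (x - k)\<close>, which turns a negative power
  of \<open>x\<close> into its value at \<open>k + 1\<close> times an integrable singularity.\<close>

lemma powr_unit_interval_le:
  fixes e k x :: real
  assumes "0 \<le> k" "k < x" "x \<le> k + 1" "e \<le> 0"
  shows "x powr e \<le> (k + 1) powr e * (x - k) powr e"
proof -
  have "k * (x - k) \<le> k * 1"
    using assms by (intro mult_left_mono) auto
  then have "(k + 1) * (x - k) \<le> x"
    by (simp add: algebra_simps)
  then have "x powr e \<le> ((k + 1) * (x - k)) powr e"
    using assms by (intro powr_mono2') auto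
  then show ?thesis
    using assms by (simp add: powr_mult)
qed

text \<open>The bound is a constant depending on i and j times a function of u times a function of
  v, so the double integral over the unit square factorises. The 8 is 2 * 4: the ratio (j + 1) / v
  is at most 2, and 1 / (H/2) is at most 4.\<close>

lemma volterra_integral_le_unit_square:
  assumes H: "1 / 2 < H" "H < 1" and ij: "1 \<le> i" "i \<le> j"
    and u: "u \<in> {real i - 1<..<real i}" and v: "v \<in> {real j<..<real j + 1}"
  shows "volterra_integral H (real j + 1) u v \<le>
    8 * ((real j + 1) / real i) powr (H / 2) * (real j + 1 - real i) powr (H / 2 - 1) *
      ((u - (real i - 1)) powr (- H / 2) * (v - real j) powr (H / 2 - 1))"
proof -
  let ?T = "real j + 1"
  have pos: "0 < u" "u < v" "v < ?T" "0 < real i" "0 < ?T" "0 < v" "1 \<le> real j"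
    using u v ij by auto
  have "(?T / v) powr (H / 2) \<le> 2 powr (H / 2)"
    using pos v H by (intro powr_mono2) (auto simp: field_simps)
  also have "\<dots> \<le> 2 powr 1"
    using H by (intro powr_mono) auto
  finally have Tv: "(?T / v) powr (H / 2) \<le> 2"
    by simp
  have "(?T - v) powr (H / 2) \<le> 1 powr (H / 2)"
    using pos v H by (intro powr_mono2) auto
  then have last: "(?T - v) powr (H / 2) / (H / 2) \<le> 4"
    using H by (simp add: field_simps)
  have "u powr (- H / 2) \<le> (real i - 1 + 1) powr (- H / 2) * (u - (real i - 1)) powr (- H / 2)"
    using u ij H by (intro powr_unit_interval_le) auto
  then have "?T powr (H / 2) * u powr (- H / 2)
      \<le> ?T powr (H / 2) * (real i powr (- H / 2) * (u - (real i - 1)) powr (- H / 2))"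
    by (intro mult_left_mono) auto
  then have Tu: "(?T / u) powr (H / 2) \<le> (?T / real i) powr (H / 2) * (u - (real i - 1)) powr (- H / 2)"
    using pos powr_minus_divide[of u "H / 2"] powr_minus_divide[of "real i" "H / 2"]
    by (simp add: powr_divide)
  \<comment> \<open>Since u < i, the gap v - u exceeds v - i, which lies in the unit interval
    starting at j - i. This includes the touching cells i = j, where the gap has no positive lower
    bound.\<close>
  have "(v - u) powr (H / 2 - 1) \<le> (v - real i) powr (H / 2 - 1)"
    using u v ij H by (intro powr_mono2') auto
  also have "\<dots> \<le> (real j - real i + 1) powr (H / 2 - 1) * (v - real i - (real j - real i)) powr (H / 2 - 1)"
    using v ij H by (intro powr_unit_interval_le) auto
  finally have vu: "(v - u) powr (H / 2 - 1) \<le> (?T - real i) powr (H / 2 - 1) * (v - real j) powr (H / 2 - 1)"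
    by (simp add: algebra_simps)
  have "volterra_integral H ?T u v \<le>
      ((?T / real i) powr (H / 2) * (u - (real i - 1)) powr (- H / 2)) * 2 *
      ((?T - real i) powr (H / 2 - 1) * (v - real j) powr (H / 2 - 1)) * 4"
    using volterra_integral_le[OF H pos(1,2,3)] Tu Tv vu last H pos
    by (elim order_trans) (intro mult_mono, auto)
  then show ?thesis
    by (simp add: mult_ac)
qed

text \<open>Positivity will make the Gaussian variables g_j non-degenerate; the upper bound will
  control their variances. Both follow by integrating the pointwise bounds first in v, then in u,
  where strict positivity requires integrability at each stage.\<close>

lemma
  assumes H: "1 / 2 < H" "H < 1" and ij: "1 \<le> i" "i \<le> j"
  shows rosenblatt_coeff_pos: "0 < rosenblatt_coeff H j i"
    and rosenblatt_coeff_le: "rosenblatt_coeff H j i \<le>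
      rosenblatt_factor H * 64 *
        (((real j + 1) / real i) powr (H / 2) * (real j + 1 - real i) powr (H / 2 - 1))"
proof -
  let ?T = "real j + 1"
  define D where "D = 8 * (?T / real i) powr (H / 2) * (?T - real i) powr (H / 2 - 1)"
  define f where "f = (\<lambda>u. (u - (real i - 1)) powr (- H / 2))"
  define g where "g = (\<lambda>v. (v - real j) powr (H / 2 - 1))"
  define I where "I = (\<lambda>u. LBINT v:{real j..?T}. volterra_integral H ?T u v)"
  have D: "0 \<le> D"
    by (simp add: D_def)
  have le: "volterra_integral H ?T u v \<le> D * f u * g v"
    if "u \<in> {real i - 1<..<real i}" "v \<in> {real j<..<?T}" for u v
    using volterra_integral_le_unit_square[OF H ij that] by (simp add: D_def f_def g_def mult.assoc)
  have pos: "0 < volterra_integral H ?T u v"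
    if "u \<in> {real i - 1<..<real i}" "v \<in> {real j<..<?T}" for u v
    using that ij H by (intro volterra_integral_pos) auto
  have g: "set_integrable lborel {real j..?T} g" "(LBINT v:{real j..?T}. g v) = 2 / H"
    unfolding g_def using H set_integrable_powr_shift[of "H / 2 - 1" "real j" ?T]
      LBINT_powr_shift[of "H / 2 - 1" "real j" ?T] by simp_all
  have f: "set_integrable lborel {real i - 1..real i} f"
    "(LBINT u:{real i - 1..real i}. f u) = 1 / (1 - H / 2)"
    unfolding f_def using H set_integrable_powr_shift[of "- H / 2" "real i - 1" "real i"]
      LBINT_powr_shift[of "- H / 2" "real i - 1" "real i"] by simp_all
  have int_v: "set_integrable lborel {real j..?T} (\<lambda>v. volterra_integral H ?T u v)"
    if u: "u \<in> {real i - 1<..<real i}" for u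
  proof (rule set_integrable_bound)
    show "set_integrable lborel {real j..?T} (\<lambda>v. D * f u * g v)"
      using g by (intro set_integrable_mult_right)
    show "set_borel_measurable lborel {real j..?T} (volterra_integral H ?T u)"
      unfolding set_borel_measurable_def
      using measurable_compose[OF measurable_Pair1'[of u borel borel] measurable_volterra_integral[of H ?T]]
      by simp
    have "AE v in lborel. v \<noteq> real j \<and> v \<noteq> ?T"
      using AE_lborel_singleton[of "real j"] AE_lborel_singleton[of ?T] by auto
    then show "AE v in lborel. v \<in> {real j..?T} \<longrightarrow> norm (volterra_integral H ?T u v) \<le> norm (D * f u * g v)"
    proof eventually_elim
      case (elim v)
      then show ?case
        using le[OF u, of v] pos[OF u, of v] by auto
    qed
  qed
  have I_le: "I u \<le> D * (2 / H) * f u" if u: "u \<in> {real i - 1<..<real i}" for u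
  proof -
    have "I u \<le> (LBINT v:{real j..?T}. D * f u * g v)"
      unfolding I_def
      using g le[OF u] D by (intro LBINT_mono_interior set_integrable_mult_right)
        (auto simp: f_def g_def)
    with g show ?thesis
      by (simp add: mult_ac)
  qed
  have I_pos: "0 < I u" if u: "u \<in> {real i - 1<..<real i}" for u
    unfolding I_def using int_v[OF u] pos[OF u] by (intro LBINT_pos_interior) auto
  have I_meas: "I \<in> borel_measurable borel"
    unfolding I_def set_lebesgue_integral_def
    using measurable_volterra_integral[of H ?T] by measurable
  have int_u: "set_integrable lborel {real i - 1..real i} I"
  proof (rule set_integrable_bound)
    show "set_integrable lborel {real i - 1..real i} (\<lambda>u. D * (2 / H) * f u)"
      using f by (intro set_integrable_mult_right)
    show "set_borel_measurable lborel {real i - 1..real i} I"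
      unfolding set_borel_measurable_def using I_meas by simp
    have "AE u in lborel. u \<noteq> real i - 1 \<and> u \<noteq> real i"
      using AE_lborel_singleton[of "real i - 1"] AE_lborel_singleton[of "real i"] by auto
    then show "AE u in lborel. u \<in> {real i - 1..real i} \<longrightarrow> norm (I u) \<le> norm (D * (2 / H) * f u)"
    proof eventually_elim
      case (elim u)
      then show ?case
        using I_le[of u] I_pos[of u] order_trans[OF _ abs_ge_self[of "D * (2 / H) * f u"]]
        by (auto simp del: times_divide_eq_right)
    qed
  qed
  have coeff: "rosenblatt_coeff H j i = rosenblatt_factor H * (LBINT u:{real i - 1..real i}. I u)"
  proof -
    have "rosenblatt_coeff H j i = (LBINT u:{real i - 1..real i}. LBINT v:{real j..?T}.
        rosenblatt_factor H * volterra_integral H ?T u v)"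
      unfolding rosenblatt_coeff_def
    proof (intro LBINT_cong_interior)
      fix u v
      assume "u \<in> {real i - 1<..<real i}" "v \<in> {real j<..<?T}"
      then show "rosenblatt_kernel H ?T u v = rosenblatt_factor H * volterra_integral H ?T u v"
        unfolding volterra_integral_def using ij by (intro rosenblatt_kernel_eq H) auto
    qed
    then show ?thesis
      by (simp add: I_def)
  qed
  show "0 < rosenblatt_coeff H j i"
    unfolding coeff using int_u I_pos
    by (intro mult_pos_pos rosenblatt_factor_pos H LBINT_pos_interior) auto
  have "(LBINT u:{real i - 1..real i}. I u) \<le> (LBINT u:{real i - 1..real i}. D * (2 / H) * f u)"
    using f I_le D H by (intro LBINT_mono_interior set_integrable_mult_right) (auto simp: f_def)
  also have "\<dots> = D * (2 / H) * (1 / (1 - H / 2))"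
    using f by simp
  \<comment> \<open>Here 2 / H < 4 because H > 1/2, and 1 / (1 - H/2) < 2 because H < 1. With the 8
    inside \<open>D\<close> this yields 64.\<close>
  also have "\<dots> \<le> D * 4 * 2"
    using H D by (intro mult_mono) (auto simp: field_simps)
  finally show "rosenblatt_coeff H j i \<le> rosenblatt_factor H * 64 *
        ((?T / real i) powr (H / 2) * (?T - real i) powr (H / 2 - 1))"
    unfolding coeff using rosenblatt_factor_pos[OF H] by (simp add: D_def mult_left_mono)
qed

section \<open>Uniform bound on the variances\<close>

text \<open>Write j + 1 = a + b with a = i. If b \<le> a, the ratio (a + b) / a is at most 2 and the
  term is at most 2 b^(H - 2). Otherwise it is at most 2 b / a, and b^(2H - 2) \<le> a^(2H - 2)
  leaves 2 a^(H - 2). Both powers are summable as H - 2 < -1.\<close>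

lemma convolution_sum_le:
  fixes H :: real
  assumes H: "1 / 2 < H" "H < 1"
  shows "(\<Sum>i\<in>{1..j}. ((real j + 1) / real i) powr H * (real j + 1 - real i) powr (H - 2))
    \<le> 4 * (\<Sum>k. real k powr (H - 2))"
proof -
  let ?K = "\<Sum>k. real k powr (H - 2)"
  have term_le: "((real j + 1) / real i) powr H * (real j + 1 - real i) powr (H - 2)
      \<le> 2 * (real i powr (H - 2) + real (Suc j - i) powr (H - 2))" if i: "i \<in> {1..j}" for i
  proof -
    define a where "a = real i"
    define b where "b = real j + 1 - real i"
    have ab: "0 < a" "0 < b" "real j + 1 = a + b" "real (Suc j - i) = b"
      using i by (auto simp: a_def b_def of_nat_diff)
    have two: "2 powr H \<le> (2 :: real)"
      using powr_mono[of H 1 "2 :: real"] H by simp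
    have "((a + b) / a) powr H * b powr (H - 2) \<le> 2 * (a powr (H - 2) + b powr (H - 2))"
    proof (cases "b \<le> a")
      case True
      have "((a + b) / a) powr H \<le> 2 powr H"
        using True ab H by (intro powr_mono2) (auto simp: field_simps)
      then have "((a + b) / a) powr H * b powr (H - 2) \<le> 2 * b powr (H - 2)"
        using two by (intro mult_right_mono) auto
      then show ?thesis
        by (smt (verit) powr_ge_zero)
    next
      case False
      have "((a + b) / a) powr H \<le> (2 * (b / a)) powr H"
        using False ab H by (intro powr_mono2) (auto simp: field_simps)
      also have "\<dots> = 2 powr H * (b powr H * a powr (- H))"
        using ab by (simp add: powr_mult powr_divide powr_minus_divide)
      finally have "((a + b) / a) powr H * b powr (H - 2)
          \<le> 2 * (b powr H * a powr (- H)) * b powr (H - 2)"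
        using two by (intro mult_right_mono) (auto elim!: order_trans intro!: mult_right_mono)
      also have "\<dots> = 2 * (b powr (2 * H - 2) * a powr (- H))"
        by (simp add: mult_ac flip: powr_add)
      also have "\<dots> \<le> 2 * (a powr (2 * H - 2) * a powr (- H))"
        using False ab H by (intro mult_left_mono mult_right_mono powr_mono2') auto
      also have "\<dots> = 2 * a powr (H - 2)"
        by (simp flip: powr_add)
      finally show ?thesis
        by (smt (verit) powr_ge_zero)
    qed
    then show ?thesis
      by (simp add: ab(3,4) flip: a_def b_def)
  qed
  have "summable (\<lambda>k. real k powr (H - 2))"
    using H by (simp add: summable_real_powr_iff)
  then have sum_le: "(\<Sum>i\<in>{1..j}. real i powr (H - 2)) \<le> ?K"
    by (intro sum_le_suminf) auto
  have "(\<Sum>i\<in>{1..j}. real (Suc j - i) powr (H - 2)) = (\<Sum>i\<in>{1..j}. real i powr (H - 2))"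
    by (rule sum.reindex_bij_witness[where i = "\<lambda>i. Suc j - i" and j = "\<lambda>i. Suc j - i"]) auto
  then have "(\<Sum>i\<in>{1..j}. 2 * (real i powr (H - 2) + real (Suc j - i) powr (H - 2))) \<le> 4 * ?K"
    using sum_le by (simp add: sum.distrib flip: sum_distrib_left)
  with sum_mono[OF term_le] show ?thesis
    by (rule order_trans)
qed

text \<open>Squaring the coefficient bound doubles the exponents H/2 and H/2 - 1, which produces
  exactly the convolution sum. The right-hand side does not depend on j.\<close>

lemma rosenblatt_coeff_square_sum_le:
  assumes H: "1 / 2 < H" "H < 1"
  shows "(\<Sum>i\<in>{1..j}. (2 * rosenblatt_coeff H j i)\<^sup>2)
    \<le> (2 * (rosenblatt_factor H * 64))\<^sup>2 * (4 * (\<Sum>k. real k powr (H - 2)))"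
proof -
  have "(2 * rosenblatt_coeff H j i)\<^sup>2 \<le> (2 * (rosenblatt_factor H * 64))\<^sup>2 *
      (((real j + 1) / real i) powr H * (real j + 1 - real i) powr (H - 2))" if i: "i \<in> {1..j}" for i
  proof -
    have sq: "(x powr (H / 2))\<^sup>2 = x powr H" "(x powr (H / 2 - 1))\<^sup>2 = x powr (H - 2)" for x :: real
      by (simp_all add: power2_eq_square flip: powr_add)
    have "(2 * rosenblatt_coeff H j i)\<^sup>2 \<le> (2 * (rosenblatt_factor H * 64 *
        (((real j + 1) / real i) powr (H / 2) * (real j + 1 - real i) powr (H / 2 - 1))))\<^sup>2"
      using rosenblatt_coeff_le[OF H, of i j] rosenblatt_coeff_pos[OF H, of i j] i
      by (intro power_mono mult_left_mono) auto
    then show ?thesis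
      by (simp only: power_mult_distrib sq mult.assoc)
  qed
  then have "(\<Sum>i\<in>{1..j}. (2 * rosenblatt_coeff H j i)\<^sup>2) \<le> (\<Sum>i\<in>{1..j}. (2 * (rosenblatt_factor H * 64))\<^sup>2 *
      (((real j + 1) / real i) powr H * (real j + 1 - real i) powr (H - 2)))"
    by (rule sum_mono)
  also have "\<dots> \<le> (2 * (rosenblatt_factor H * 64))\<^sup>2 * (4 * (\<Sum>k. real k powr (H - 2)))"
    unfolding sum_distrib_left[symmetric] by (intro mult_left_mono convolution_sum_le H) simp
  finally show ?thesis .
qed

subsection \<open>Gaussian tools\<close>

text \<open>Expectation and sum commute for nonnegative terms, so the random series has finite
  expectation and is finite almost surely.\<close>

lemma AE_summable_of_expectation_bounds:
  fixes f :: "nat \<Rightarrow> 'a \<Rightarrow> real"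
  assumes [measurable]: "\<And>n. f n \<in> borel_measurable M"
    and nn: "\<And>n x. 0 \<le> f n x"
    and bound: "\<And>n. (\<integral>\<^sup>+x. ennreal (f n x) \<partial>M) \<le> ennreal (c n)"
    and c: "\<And>n. 0 \<le> c n" "summable c"
  shows "AE x in M. summable (\<lambda>n. f n x)"
proof -
  have "(\<integral>\<^sup>+x. (\<Sum>n. ennreal (f n x)) \<partial>M) = (\<Sum>n. \<integral>\<^sup>+x. ennreal (f n x) \<partial>M)"
    by (rule nn_integral_suminf) measurable
  also have "\<dots> \<le> (\<Sum>n. ennreal (c n))"
    by (intro suminf_le bound) auto
  also have "\<dots> < \<top>"
    using c by (simp add: suminf_ennreal2)
  finally have "(\<integral>\<^sup>+x. (\<Sum>n. ennreal (f n x)) \<partial>M) \<noteq> \<infinity>"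
    by simp
  then have "AE x in M. (\<Sum>n. ennreal (f n x)) \<noteq> \<infinity>"
    by (rule nn_integral_PInf_AE[rotated]) measurable
  then show ?thesis
    by eventually_elim (auto intro: summable_suminf_not_top nn)
qed

text \<open>Completing the square turns the weighted standard normal density into the normal density
  with mean c.\<close>

lemma (in prob_space) std_normal_exp_moment:
  assumes "distributed M lborel X std_normal_density"
  shows "(\<integral>\<^sup>+\<omega>. ennreal (exp (c * X \<omega> - c\<^sup>2 / 2)) \<partial>M) = 1"
proof -
  have "(\<integral>\<^sup>+\<omega>. ennreal (exp (c * X \<omega> - c\<^sup>2 / 2)) \<partial>M)
      = (\<integral>\<^sup>+y. ennreal (std_normal_density y) * ennreal (exp (c * y - c\<^sup>2 / 2)) \<partial>lborel)"
    by (rule distributed_nn_integral[OF assms, symmetric]) simp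
  also have "\<dots> = (\<integral>\<^sup>+y. ennreal (normal_density c 1 y) \<partial>lborel)"
  proof (rule nn_integral_cong)
    fix y :: real
    have "std_normal_density y * exp (c * y - c\<^sup>2 / 2) = normal_density c 1 y"
      by (simp add: normal_density_def power2_eq_square algebra_simps flip: exp_add)
    then show "ennreal (std_normal_density y) * ennreal (exp (c * y - c\<^sup>2 / 2))
        = ennreal (normal_density c 1 y)"
      by (simp flip: ennreal_mult'')
  qed
  also have "\<dots> = 1"
    by (simp add: nn_integral_eq_integral)
  finally show ?thesis .
qed

text \<open>The expectation of an exponential martingale. Given the first n noises, the factor with
  index n has expectation 1 by \<open>std_normal_exp_moment\<close>; independence realises this
  conditioning by Fubini. Nonnegative integrals avoid any moment condition on h. The restriction
  hypothesis expresses that \<open>h j\<close> sees only the first j noises.\<close>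

lemma (in prob_space) nn_integral_exp_predictable_transform:
  fixes \<xi> :: "nat \<Rightarrow> 'a \<Rightarrow> real" and h :: "nat \<Rightarrow> (nat \<Rightarrow> real) \<Rightarrow> real"
  assumes indep: "indep_vars (\<lambda>_. borel) \<xi> {1..}"
    and normal: "\<And>i. i \<ge> 1 \<Longrightarrow> distributed M lborel (\<xi> i) std_normal_density"
    and meas: "\<And>j. h j \<in> borel_measurable (PiM {1..j} (\<lambda>_. borel))"
    and local: "\<And>j x. h j (restrict x {1..j}) = h j x"
  shows "(\<integral>\<^sup>+\<omega>. ennreal (exp (\<Sum>j<n. h j (\<lambda>i. \<xi> i \<omega>) * \<xi> (Suc j) \<omega> - (h j (\<lambda>i. \<xi> i \<omega>))\<^sup>2 / 2)) \<partial>M) = 1"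
proof (induction n)
  case 0
  show ?case
    by (simp add: emeasure_space_1)
next
  case (Suc n)
  define E where "E = (\<lambda>x :: nat \<Rightarrow> real. \<Sum>j<n. h j x * x (Suc j) - (h j x)\<^sup>2 / 2)"
  let ?P = "PiM {1..n} (\<lambda>_. borel) :: (nat \<Rightarrow> real) measure"
  let ?R = "\<lambda>\<omega>. restrict (\<lambda>i. \<xi> i \<omega>) {1..n}"
  have hn: "h j \<in> borel_measurable ?P" if "j \<le> n" for j
  proof -
    have "(\<lambda>x. h j (restrict x {1..j})) \<in> borel_measurable ?P"
      using that by (intro measurable_compose[OF measurable_restrict_subset meas]) auto
    then show ?thesis
      by (simp only: local)
  qed
  have E_local: "E (restrict x {1..n}) = E x" for x
  proof -
    have "h j (restrict x {1..n}) = h j x" if "j < n" for j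
      using local[of j "restrict x {1..n}"] local[of j x] that by (simp add: Int_absorb1)
    then show ?thesis
      by (simp add: E_def)
  qed
  have E_meas [measurable]: "E \<in> borel_measurable ?P"
    unfolding E_def using hn by (intro borel_measurable_sum) auto
  note hn[OF order_refl, measurable]
  \<comment> \<open>The next noise is viewed as a family over a singleton index set, the form in
    which independence of disjoint blocks is delivered.\<close>
  let ?Q = "PiM {Suc n} (\<lambda>_. borel) :: (nat \<Rightarrow> real) measure"
  let ?T = "\<lambda>\<omega>. restrict (\<lambda>i. \<xi> i \<omega>) {Suc n}"
  have ind: "indep_var ?P ?R ?Q ?T"
    by (rule indep_var_restrict[OF indep]) auto
  have [measurable]: "?R \<in> measurable M ?P" "?T \<in> measurable M ?Q"
    using ind by (blast dest: indep_var_rv1 indep_var_rv2)+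
  have [measurable]: "(\<lambda>y. y (Suc n)) \<in> borel_measurable ?Q"
    by (rule measurable_component_singleton) simp
  have eq: "distr M ?P ?R \<Otimes>\<^sub>M distr M ?Q ?T = distr M (?P \<Otimes>\<^sub>M ?Q) (\<lambda>\<omega>. (?R \<omega>, ?T \<omega>))"
    using ind by (simp add: indep_var_distribution_eq)
  interpret T: prob_space "distr M ?Q ?T"
    by (rule prob_space_distr) measurable
  have R: "h n (?R \<omega>) = h n (\<lambda>i. \<xi> i \<omega>)" "E (?R \<omega>) = E (\<lambda>i. \<xi> i \<omega>)" for \<omega>
    by (rule local E_local)+
  let ?G = "\<lambda>x y. ennreal (exp (h n x * y (Suc n) - (h n x)\<^sup>2 / 2))"
  \<comment> \<open>For a frozen past x, \<open>h n x\<close> is a constant and only one standard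
    normal variable remains.\<close>
  have inner: "(\<integral>\<^sup>+y. ?G x y \<partial>distr M ?Q ?T) = 1" for x
    using std_normal_exp_moment[OF normal[of "Suc n"], of "h n x"]
    by (subst nn_integral_distr) auto
  have "(\<integral>\<^sup>+\<omega>. ennreal (exp (\<Sum>j<Suc n. h j (\<lambda>i. \<xi> i \<omega>) * \<xi> (Suc j) \<omega> - (h j (\<lambda>i. \<xi> i \<omega>))\<^sup>2 / 2)) \<partial>M)
      = (\<integral>\<^sup>+\<omega>. ennreal (exp (E (?R \<omega>))) * ?G (?R \<omega>) (?T \<omega>) \<partial>M)"
    unfolding R unfolding E_def by (simp flip: ennreal_mult' exp_add)
  also have "\<dots> = (\<integral>\<^sup>+p. ennreal (exp (E (fst p))) * ?G (fst p) (snd p)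
      \<partial>distr M (?P \<Otimes>\<^sub>M ?Q) (\<lambda>\<omega>. (?R \<omega>, ?T \<omega>)))"
    by (subst nn_integral_distr; (simp only: fst_conv snd_conv | measurable))
  also have "\<dots> = (\<integral>\<^sup>+p. ennreal (exp (E (fst p))) * ?G (fst p) (snd p)
      \<partial>(distr M ?P ?R \<Otimes>\<^sub>M distr M ?Q ?T))"
    by (simp only: eq)
  also have "\<dots> = (\<integral>\<^sup>+x. \<integral>\<^sup>+y. ennreal (exp (E x)) * ?G x y \<partial>distr M ?Q ?T \<partial>distr M ?P ?R)"
    by (subst T.nn_integral_fst[symmetric]; (simp only: fst_conv snd_conv | measurable))
  also have "\<dots> = (\<integral>\<^sup>+x. ennreal (exp (E x)) \<partial>distr M ?P ?R)"
    by (subst nn_integral_cmult; (simp only: inner mult_1_right | measurable))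
  also have "\<dots> = (\<integral>\<^sup>+\<omega>. ennreal (exp (E (\<lambda>i. \<xi> i \<omega>))) \<partial>M)"
    by (subst nn_integral_distr; (simp only: R | measurable))
  also have "\<dots> = 1"
    using Suc.IH by (simp add: E_def)
  finally show ?case .
qed

text \<open>Since the coefficients are positive, each \<open>c i\<close> is itself the standard
  deviation of its summand, and the sum rule for independent normals applies.\<close>

lemma (in prob_space) linear_combination_std_normal:
  fixes \<xi> :: "nat \<Rightarrow> 'a \<Rightarrow> real"
  assumes indep: "indep_vars (\<lambda>_. borel) \<xi> I"
    and normal: "\<And>i. i \<in> I \<Longrightarrow> distributed M lborel (\<xi> i) std_normal_density"
    and J: "finite J" "J \<noteq> {}" "J \<subseteq> I" and c: "\<And>i. i \<in> J \<Longrightarrow> 0 < c i"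
  shows "distributed M lborel (\<lambda>\<omega>. \<Sum>i\<in>J. c i * \<xi> i \<omega>) (normal_density 0 (sqrt (\<Sum>i\<in>J. (c i)\<^sup>2)))"
proof -
  have "indep_vars (\<lambda>_. borel) (\<lambda>i \<omega>. c i * \<xi> i \<omega>) J"
    by (rule indep_vars_compose2[OF indep_vars_subset[OF indep J(3)]]) auto
  moreover have "distributed M lborel (\<lambda>\<omega>. c i * \<xi> i \<omega>) (normal_density 0 (c i))" if "i \<in> J" for i
  proof -
    have "c i \<noteq> 0"
      using c[OF that] by simp
    then show ?thesis
      using normal_density_affine[OF normal[of i], of "c i" 0] J(3) c[OF that] that by auto
  qed
  ultimately show ?thesis
    using sum_indep_normal[OF J(1,2), of "\<lambda>i \<omega>. c i * \<xi> i \<omega>" c "\<lambda>_. 0"] c by simp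
qed

lemma (in prob_space) centred_normal_second_moment:
  assumes "distributed M lborel X (normal_density 0 \<sigma>)" "0 < \<sigma>"
  shows "(\<integral>\<^sup>+\<omega>. ennreal ((X \<omega>)\<^sup>2) \<partial>M) = ennreal (\<sigma>\<^sup>2)"
proof -
  have "(\<integral>\<^sup>+\<omega>. ennreal ((X \<omega>)\<^sup>2) \<partial>M) = (\<integral>\<^sup>+x. ennreal (normal_density 0 \<sigma> x) * ennreal (x\<^sup>2) \<partial>lborel)"
    by (rule distributed_nn_integral[OF assms(1), symmetric]) simp
  also have "\<dots> = (\<integral>\<^sup>+x. ennreal (normal_density 0 \<sigma> x * (x - 0) ^ (2 * 1)) \<partial>lborel)"
    by (simp add: ennreal_mult)
  also have "\<dots> = ennreal (\<sigma>\<^sup>2)"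
    using normal_moment_even[OF assms(2), of 0 1]
    by (subst nn_integral_eq_integral)
      (auto simp: has_bochner_integral_iff)
  finally show ?thesis .
qed

text \<open>A law with a Lebesgue density has no atoms.\<close>

lemma (in prob_space) AE_normal_neq:
  assumes "distributed M lborel X (normal_density \<mu> \<sigma>)"
  shows "AE \<omega> in M. X \<omega> \<noteq> c"
proof -
  have "AE x in density lborel (\<lambda>x. ennreal (normal_density \<mu> \<sigma> x)). x \<noteq> c"
    using AE_lborel_singleton[of c] by (auto simp: AE_density elim: eventually_mono)
  then have "AE x in distr M lborel X. x \<noteq> c"
    by (simp only: distributed_distr_eq_density[OF assms])
  then show ?thesis
    using distributed_measurable[OF assms] by (subst (asm) AE_distr_iff) auto
qed

section \<open>The rescaled coefficients as Gaussian variables\<close>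

lemma measurable_unit_coeff:
  "(\<lambda>x. unit_coeff H x j) \<in> borel_measurable (PiM {1..j} (\<lambda>_. borel))"
  unfolding unit_coeff_def by measurable

lemma unit_coeff_restrict: "unit_coeff H (restrict x {1..j}) j = unit_coeff H x j"
  by (simp add: unit_coeff_def)

lemma (in prob_space)
  fixes \<xi> :: "nat \<Rightarrow> 'a \<Rightarrow> real"
  assumes H: "1 / 2 < H" "H < 1"
    and indep: "indep_vars (\<lambda>_. borel) \<xi> {1..}"
    and normal: "\<And>i. i \<ge> 1 \<Longrightarrow> distributed M lborel (\<xi> i) std_normal_density"
  shows AE_unit_coeff_neq_0: "AE \<omega> in M. unit_coeff H (\<lambda>i. \<xi> i \<omega>) j \<noteq> 0"
    and unit_coeff_second_moment:
      "\<exists>C. \<forall>j. (\<integral>\<^sup>+\<omega>. ennreal ((unit_coeff H (\<lambda>i. \<xi> i \<omega>) j)\<^sup>2) \<partial>M) \<le> ennreal C"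
proof -
  define \<sigma> where "\<sigma> j = sqrt (\<Sum>i\<in>{1..j}. (2 * rosenblatt_coeff H j i)\<^sup>2)" for j
  have dist: "distributed M lborel (\<lambda>\<omega>. unit_coeff H (\<lambda>i. \<xi> i \<omega>) j) (normal_density 0 (\<sigma> j))"
    and \<sigma>: "0 < \<sigma> j" if "j \<noteq> 0" for j
  proof -
    show "distributed M lborel (\<lambda>\<omega>. unit_coeff H (\<lambda>i. \<xi> i \<omega>) j) (normal_density 0 (\<sigma> j))"
      using linear_combination_std_normal[OF indep normal, of "{1..j}" "\<lambda>i. 2 * rosenblatt_coeff H j i"]
        that rosenblatt_coeff_pos[OF H]
      by (simp add: unit_coeff_def \<sigma>_def)
    have "0 < (\<Sum>i\<in>{1..j}. (2 * rosenblatt_coeff H j i)\<^sup>2)"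
      using that rosenblatt_coeff_pos[OF H, of _ j] by (intro sum_pos) (auto simp: less_imp_neq[symmetric])
    then show "0 < \<sigma> j"
      by (simp add: \<sigma>_def)
  qed
  show "AE \<omega> in M. unit_coeff H (\<lambda>i. \<xi> i \<omega>) j \<noteq> 0"
    by (cases "j = 0") (auto simp: unit_coeff_def[of H _ 0] intro: AE_normal_neq[OF dist])
  define C where "C = (2 * (rosenblatt_factor H * 64))\<^sup>2 * (4 * (\<Sum>k. real k powr (H - 2)))"
  \<comment> \<open>The maximum with 1 accounts for j = 0, where the coefficient is the constant 1
    and not a Gaussian variable.\<close>
  have "(\<integral>\<^sup>+\<omega>. ennreal ((unit_coeff H (\<lambda>i. \<xi> i \<omega>) j)\<^sup>2) \<partial>M) \<le> ennreal (max 1 C)" for j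
  proof (cases "j = 0")
    case True
    then show ?thesis
      using ennreal_leI[of 1 "max 1 C"] by (simp add: unit_coeff_def emeasure_space_1)
  next
    case False
    have "(\<integral>\<^sup>+\<omega>. ennreal ((unit_coeff H (\<lambda>i. \<xi> i \<omega>) j)\<^sup>2) \<partial>M) = ennreal ((\<sigma> j)\<^sup>2)"
      by (rule centred_normal_second_moment[OF dist \<sigma>]) (rule False)+
    also have "(\<sigma> j)\<^sup>2 \<le> max 1 C"
      using rosenblatt_coeff_square_sum_le[OF H, of j] by (simp add: \<sigma>_def C_def sum_nonneg)
    finally show ?thesis
      by (simp add: ennreal_leI)
  qed
  then show "\<exists>C. \<forall>j. (\<integral>\<^sup>+\<omega>. ennreal ((unit_coeff H (\<lambda>i. \<xi> i \<omega>) j)\<^sup>2) \<partial>M) \<le> ennreal C"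
    by blast
qed

subsection \<open>The estimation error\<close>

text \<open>After f_j is subtracted, the increment is a / N + g_j times the next noise. The drift
  part reproduces a after normalisation, and with g_j of order N^(-H) the noise part carries the
  factor N / N^H.\<close>

lemma drift_estimator_error:
  fixes \<gamma> :: "nat \<Rightarrow> real"
  assumes H: "1 / 2 < H" "H < 1" and N: "1 \<le> N"
    and \<gamma>: "\<gamma> = unit_coeff H x" and nz: "\<And>j. \<gamma> j \<noteq> 0" and n: "n = num_obs \<alpha> N" "1 \<le> n"
  shows "drift_estimator H \<alpha> N x (observation H a N x) =
    a + real N powr (1 - H) * (\<Sum>j<n. x (Suc j) / \<gamma> j) / (\<Sum>j<n. 1 / (\<gamma> j)\<^sup>2)"
proof -
  define p where "p = real N powr H"
  have p: "0 < p" "0 < real N"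
    using N by (simp_all add: p_def)
  have g: "coeff_g H N x j = \<gamma> j / p" for j
    using coeff_g_eq[OF H N] by (simp add: \<gamma> p_def)
  have A: "0 < (\<Sum>j<n. 1 / (\<gamma> j)\<^sup>2)"
    using n nz by (intro sum_pos) (auto simp: lessThan_empty_iff)
  have "(observation H a N x (Suc j) - observation H a N x j - coeff_f H N x j) / (coeff_g H N x j)\<^sup>2
      = a / N * p\<^sup>2 * (1 / (\<gamma> j)\<^sup>2) + p * (x (Suc j) / \<gamma> j)" for j
    using p nz[of j] by (simp add: g field_simps power2_eq_square)
  then have "(\<Sum>j<n. (observation H a N x (Suc j) - observation H a N x j - coeff_f H N x j) / (coeff_g H N x j)\<^sup>2)
      = a / N * p\<^sup>2 * (\<Sum>j<n. 1 / (\<gamma> j)\<^sup>2) + p * (\<Sum>j<n. x (Suc j) / \<gamma> j)"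
    by (simp only: sum.distrib sum_distrib_left)
  moreover have "(\<Sum>j<n. 1 / (coeff_g H N x j)\<^sup>2) = p\<^sup>2 * (\<Sum>j<n. 1 / (\<gamma> j)\<^sup>2)"
    by (simp add: g power_divide sum_distrib_left)
  ultimately have "drift_estimator H \<alpha> N x (observation H a N x) =
      N * (a / N * p\<^sup>2 * (\<Sum>j<n. 1 / (\<gamma> j)\<^sup>2) + p * (\<Sum>j<n. x (Suc j) / \<gamma> j))
        / (p\<^sup>2 * (\<Sum>j<n. 1 / (\<gamma> j)\<^sup>2))"
    by (simp add: drift_estimator_def n(1))
  also have "\<dots> = a + (N / p) * (\<Sum>j<n. x (Suc j) / \<gamma> j) / (\<Sum>j<n. 1 / (\<gamma> j)\<^sup>2)"
    using p A by (simp add: field_simps power2_eq_square)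
  finally show ?thesis
    using p by (simp add: powr_diff p_def)
qed

text \<open>One constant for all finite index sets serves both uses below: partial sums and, through
  singletons, individual terms.\<close>

lemma summable_nonneg_bounded:
  fixes f :: "nat \<Rightarrow> real"
  assumes "summable f" "\<And>n. 0 \<le> f n"
  shows "\<exists>K>0. \<forall>F. finite F \<longrightarrow> sum f F \<le> K"
proof (intro exI conjI allI impI)
  show "0 < suminf f + 1"
    using suminf_nonneg[OF assms] by simp
  show "sum f F \<le> suminf f + 1" if "finite F" for F
    using sum_le_suminf[OF assms(1) that] assms(2) by simp
qed

text \<open>The weights are at least n^(-1 - \<delta>), so the sum of squares is at most C n^(1 +
  \<delta>). Cauchy-Schwarz applied to n as the sum of \<open>\<gamma> j * (1 / \<gamma> j)\<close>
  then bounds the sum of inverse squares from below.\<close>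

lemma inverse_square_sum_ge:
  fixes \<gamma> :: "nat \<Rightarrow> real"
  assumes nz: "\<And>j. \<gamma> j \<noteq> 0" and n: "1 \<le> n" and \<delta>: "0 \<le> \<delta>"
    and C: "0 < C" "(\<Sum>j<n. (\<gamma> j)\<^sup>2 / real (Suc j) powr (1 + \<delta>)) \<le> C"
  shows "real n powr (1 - \<delta>) \<le> C * (\<Sum>j<n. 1 / (\<gamma> j)\<^sup>2)"
proof -
  have "(\<Sum>j<n. (\<gamma> j)\<^sup>2) \<le> (\<Sum>j<n. real n powr (1 + \<delta>) * ((\<gamma> j)\<^sup>2 / real (Suc j) powr (1 + \<delta>)))"
  proof (rule sum_mono)
    fix j assume "j \<in> {..<n}"
    then have "real (Suc j) powr (1 + \<delta>) \<le> real n powr (1 + \<delta>)"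
      using \<delta> by (intro powr_mono2) auto
    then have "(\<gamma> j)\<^sup>2 * real (Suc j) powr (1 + \<delta>) \<le> (\<gamma> j)\<^sup>2 * real n powr (1 + \<delta>)"
      by (intro mult_left_mono) auto
    then show "(\<gamma> j)\<^sup>2 \<le> real n powr (1 + \<delta>) * ((\<gamma> j)\<^sup>2 / real (Suc j) powr (1 + \<delta>))"
      by (simp add: field_simps)
  qed
  also have "\<dots> \<le> real n powr (1 + \<delta>) * C"
    unfolding sum_distrib_left[symmetric] by (intro mult_left_mono C) simp
  finally have le: "(\<Sum>j<n. (\<gamma> j)\<^sup>2) \<le> real n powr (1 + \<delta>) * C" .
  have "(real n)\<^sup>2 = (\<Sum>j<n. \<gamma> j * (1 / \<gamma> j))\<^sup>2"
    using nz by simp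
  also have "\<dots> \<le> (\<Sum>j<n. (\<gamma> j)\<^sup>2) * (\<Sum>j<n. (1 / \<gamma> j)\<^sup>2)"
    by (rule Cauchy_Schwarz_ineq_sum)
  also have "\<dots> \<le> real n powr (1 + \<delta>) * C * (\<Sum>j<n. 1 / (\<gamma> j)\<^sup>2)"
    using le by (simp add: power_divide) (intro mult_right_mono sum_nonneg, auto)
  finally have "real n powr (1 + \<delta>) * real n powr (1 - \<delta>)
      \<le> real n powr (1 + \<delta>) * (C * (\<Sum>j<n. 1 / (\<gamma> j)\<^sup>2))"
    using n by (simp add: mult.assoc powr_numeral flip: powr_add)
  then show ?thesis
    using n by simp
qed

lemma num_obs_ge:
  assumes "1 \<le> N" "0 \<le> \<alpha>"
  shows "1 \<le> num_obs \<alpha> N" "real N powr \<alpha> \<le> 2 * real (num_obs \<alpha> N)"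
proof -
  have "1 \<le> real N powr \<alpha>"
    using assms by (simp add: ge_one_powr_ge_zero)
  moreover from this have "real (num_obs \<alpha> N) = real_of_int \<lfloor>real N powr \<alpha>\<rfloor>"
    by (simp add: num_obs_def)
  moreover from calculation(1) have "1 \<le> real_of_int \<lfloor>real N powr \<alpha>\<rfloor>"
    by simp
  moreover have "real N powr \<alpha> < real_of_int \<lfloor>real N powr \<alpha>\<rfloor> + 1"
    by linarith
  ultimately show "1 \<le> num_obs \<alpha> N" "real N powr \<alpha> \<le> 2 * real (num_obs \<alpha> N)"
    by linarith+
qed

text \<open>Taking logarithms of the two exponential bounds controls S and - S; dividing by
  \<open>L * A\<close> gives the estimate.\<close>

lemma normalised_sum_le:
  fixes S A L \<delta> :: real
  assumes A: "0 < A" and L: "0 < L" and K: "0 < K" "0 < m"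
    and up: "exp (L * S - L\<^sup>2 * A / 2) \<le> K * m" and lo: "exp (- L * S - L\<^sup>2 * A / 2) \<le> K * m"
  shows "\<bar>S / A\<bar> \<le> L / 2 + (ln K + ln m) / (L * A)"
proof -
  have "L * S - L\<^sup>2 * A / 2 \<le> ln (K * m)" "- L * S - L\<^sup>2 * A / 2 \<le> ln (K * m)"
    using up lo K by (simp_all add: ln_ge_iff)
  then have "L * \<bar>S\<bar> \<le> L\<^sup>2 * A / 2 + (ln K + ln m)"
    using K by (simp add: ln_mult abs_if)
  then have "L * \<bar>S\<bar> / (L * A) \<le> (L\<^sup>2 * A / 2 + (ln K + ln m)) / (L * A)"
    using A L by (intro divide_right_mono) auto
  then show ?thesis
    using A L by (simp add: abs_divide add_divide_distrib power2_eq_square)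
qed

text \<open>The deterministic core, for one fixed realisation: all probabilistic input is packed
  into the three summability hypotheses. The margin \<alpha> - 2 (1 - H) equals 4 e, and \<delta> =
  e / \<alpha> turns n^(1 - \<delta>) into order N^(\<alpha> - e).\<close>

lemma pathwise_normalised_sum_tendsto_0:
  fixes \<gamma> x :: "nat \<Rightarrow> real" and H \<alpha> :: real
  defines "e \<equiv> (\<alpha> - 2 * (1 - H)) / 4"
  defines "L \<equiv> \<lambda>N. real N powr - (1 - H + e)"
  defines "S \<equiv> \<lambda>N. \<Sum>j<num_obs \<alpha> N. x (Suc j) / \<gamma> j"
    and "A \<equiv> \<lambda>N. \<Sum>j<num_obs \<alpha> N. 1 / (\<gamma> j)\<^sup>2"
  assumes H: "H < 1" and \<alpha>: "2 - 2 * H < \<alpha>" and nz: "\<And>j. \<gamma> j \<noteq> 0"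
    and summ: "summable (\<lambda>j. (\<gamma> j)\<^sup>2 / real (Suc j) powr (1 + e / \<alpha>))"
    and up: "summable (\<lambda>N. exp (L N * S N - (L N)\<^sup>2 * A N / 2) / (real (Suc N))\<^sup>2)"
    and lo: "summable (\<lambda>N. exp (- L N * S N - (L N)\<^sup>2 * A N / 2) / (real (Suc N))\<^sup>2)"
  shows "(\<lambda>N. real N powr (1 - H) * S N / A N) \<longlonglongrightarrow> 0"
proof -
  have e: "0 < e" "0 < \<alpha>" "0 \<le> e / \<alpha>" "e / \<alpha> < 1"
    using H \<alpha> by (auto simp: e_def field_simps)
  have "\<exists>C>0. \<forall>F. finite F \<longrightarrow> (\<Sum>j\<in>F. (\<gamma> j)\<^sup>2 / real (Suc j) powr (1 + e / \<alpha>)) \<le> C"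
    by (rule summable_nonneg_bounded[OF summ]) simp
  then obtain C where C: "0 < C" "\<And>n. (\<Sum>j<n. (\<gamma> j)\<^sup>2 / real (Suc j) powr (1 + e / \<alpha>)) \<le> C"
    by blast
  have term_bounded: "\<exists>K>0. \<forall>n. f n \<le> K" if "summable f" "\<And>n. 0 \<le> f n" for f :: "nat \<Rightarrow> real"
    using summable_nonneg_bounded[OF that] by (metis finite.intros sum.empty sum.insert_if
      add.right_neutral empty_iff)
  have "\<exists>K>0. \<forall>N. exp (L N * S N - (L N)\<^sup>2 * A N / 2) / (real (Suc N))\<^sup>2 \<le> K"
    by (rule term_bounded[OF up]) simp
  then obtain K1 where K1: "\<And>N. exp (L N * S N - (L N)\<^sup>2 * A N / 2) / (real (Suc N))\<^sup>2 \<le> K1"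
    by blast
  have "\<exists>K>0. \<forall>N. exp (- L N * S N - (L N)\<^sup>2 * A N / 2) / (real (Suc N))\<^sup>2 \<le> K"
    by (rule term_bounded[OF lo]) simp
  then obtain K2 where K2: "\<And>N. exp (- L N * S N - (L N)\<^sup>2 * A N / 2) / (real (Suc N))\<^sup>2 \<le> K2"
    by blast
  define K where "K = max 1 (max K1 K2)"
  have K: "1 \<le> K" "K1 \<le> K" "K2 \<le> K"
    by (auto simp: K_def)
  \<comment> \<open>The first summand comes from \<open>L N / 2\<close>, the second from the
    logarithmic term; both are multiplied by N^(1 - H).\<close>
  let ?R = "\<lambda>N. real N powr (- e) / 2 + 2 * C * (ln K + 2 * ln (real N + 1)) * real N powr (- 2 * e)"
  have bound: "\<bar>real N powr (1 - H) * S N / A N\<bar> \<le> ?R N" if N: "1 \<le> N" for N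
  proof -
    define n where "n = num_obs \<alpha> N"
    have n: "1 \<le> n" "real N powr \<alpha> \<le> 2 * real n"
      using num_obs_ge[OF N, of \<alpha>] e by (auto simp: n_def)
    have "real N powr (\<alpha> - e) = (real N powr \<alpha>) powr (1 - e / \<alpha>)"
      using e by (simp add: powr_powr algebra_simps)
    also have "\<dots> \<le> (2 * real n) powr (1 - e / \<alpha>)"
      using n e by (intro powr_mono2) auto
    also have "\<dots> = 2 powr (1 - e / \<alpha>) * real n powr (1 - e / \<alpha>)"
      by (simp add: powr_mult)
    also have "\<dots> \<le> 2 powr 1 * (C * A N)"
      using inverse_square_sum_ge[OF nz n(1) e(3) C] e
      by (intro mult_mono powr_mono) (auto simp: A_def n_def)
    finally have A_ge: "real N powr (\<alpha> - e) \<le> 2 * C * A N"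
      by simp
    have A: "0 < A N"
      using A_ge C N by (smt (verit) mult_nonneg_nonpos of_nat_1 of_nat_le_iff powr_gt_zero)
    have L: "0 < L N"
      using N by (simp add: L_def)
    have lnK: "0 \<le> ln K + ln ((real (Suc N))\<^sup>2)"
      using K by simp
    have le: "exp (L N * S N - (L N)\<^sup>2 * A N / 2) \<le> K * (real (Suc N))\<^sup>2"
      "exp (- L N * S N - (L N)\<^sup>2 * A N / 2) \<le> K * (real (Suc N))\<^sup>2"
      using order_trans[OF K1 K(2), of N] order_trans[OF K2 K(3), of N]
      by (simp_all add: divide_le_eq del: of_nat_Suc)
    have "\<bar>S N / A N\<bar> \<le> L N / 2 + (ln K + ln ((real (Suc N))\<^sup>2)) / (L N * A N)"
      using K by (intro normalised_sum_le A L le) auto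
    also have "1 / A N \<le> 2 * C / real N powr (\<alpha> - e)"
      using A_ge A N by (simp add: field_simps)
    then have "1 / A N \<le> 2 * C * real N powr (e - \<alpha>)"
      using powr_minus_divide[of "real N" "\<alpha> - e"] by simp
    then have "(ln K + ln ((real (Suc N))\<^sup>2)) / L N * (1 / A N) \<le>
        (ln K + ln ((real (Suc N))\<^sup>2)) / L N * (2 * C * real N powr (e - \<alpha>))"
      using lnK L by (intro mult_left_mono) auto
    then have "L N / 2 + (ln K + ln ((real (Suc N))\<^sup>2)) / (L N * A N) \<le>
        L N / 2 + (ln K + ln ((real (Suc N))\<^sup>2)) / L N * (2 * C * real N powr (e - \<alpha>))"
      by simp
    also have "ln ((real (Suc N))\<^sup>2) = 2 * ln (real N + 1)"
      by (simp add: ln_realpow add.commute)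
    finally have "real N powr (1 - H) * \<bar>S N / A N\<bar> \<le> real N powr (1 - H) *
        (L N / 2 + (ln K + 2 * ln (real N + 1)) / L N * (2 * C * real N powr (e - \<alpha>)))"
      by (intro mult_left_mono) auto
    also have "\<dots> = (real N powr (1 - H) * L N) / 2 + 2 * C * (ln K + 2 * ln (real N + 1)) *
        (real N powr (1 - H) * (1 / L N) * real N powr (e - \<alpha>))"
      by (simp add: algebra_simps add_divide_distrib)
    also have "real N powr (1 - H) * L N = real N powr (- e)"
      by (simp add: L_def flip: powr_add)
    also have "real N powr (1 - H) * (1 / L N) * real N powr (e - \<alpha>) = real N powr (- 2 * e)"
    proof -
      have "1 / L N = real N powr (1 - H + e)"
        using powr_minus_divide[of "real N" "1 - H + e"] by (simp only: L_def) simp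
      \<comment> \<open>The error bound uses 2 (1 - H) + 2 e of the exponent \<alpha> = 2 (1 - H) +
        4 e, so 2 e is left to beat the logarithm.\<close>
      moreover have "1 - H + (1 - H + e) + (e - \<alpha>) = - 2 * e"
        by (simp add: e_def field_simps)
      ultimately show ?thesis
        by (metis powr_add)
    qed
    finally show ?thesis
      by (simp add: abs_mult)
  qed
  have "?R \<longlonglongrightarrow> 0"
    using e(1) by real_asymp
  then show ?thesis
    by (rule Lim_null_comparison[rotated]) (use bound in \<open>auto intro!: eventually_at_top_linorderI[of 1]\<close>)
qed

section \<open>From the almost sure bounds to strong consistency\<close>

theorem theorem1:
  fixes H a \<alpha> :: real
    and M :: "'a measure"
    and \<xi> :: "nat \<Rightarrow> 'a \<Rightarrow> real"
  assumes H: "1 / 2 < H" "H < 1"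
    and \<alpha>: "\<alpha> > 2 - 2 * H"
    and M: "prob_space M"
    and indep: "prob_space.indep_vars M (\<lambda>_. borel) \<xi> {1..}"
    and normal: "\<And>i. i \<ge> 1 \<Longrightarrow> distributed M lborel (\<xi> i) std_normal_density"
  shows "(AE \<omega> in M. \<forall>N\<ge>1. \<forall>j. coeff_g H N (\<lambda>i. \<xi> i \<omega>) j \<noteq> 0) \<and>
    (AE \<omega> in M. (\<lambda>N. drift_estimator H \<alpha> N (\<lambda>i. \<xi> i \<omega>) (observation H a N (\<lambda>i. \<xi> i \<omega>)))
       \<longlonglongrightarrow> a)"
proof -
  interpret prob_space M by (rule M)
  define \<gamma> where "\<gamma> \<omega> = unit_coeff H (\<lambda>i. \<xi> i \<omega>)" for \<omega>
  define e where "e = (\<alpha> - 2 * (1 - H)) / 4"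
  define L where "L N = real N powr - (1 - H + e)" for N
  define S where "S \<omega> N = (\<Sum>j<num_obs \<alpha> N. \<xi> (Suc j) \<omega> / \<gamma> \<omega> j)" for \<omega> N
  define A where "A \<omega> N = (\<Sum>j<num_obs \<alpha> N. 1 / (\<gamma> \<omega> j)\<^sup>2)" for \<omega> N
  have e: "0 < e / \<alpha>" "0 \<le> \<alpha>"
    using H \<alpha> by (auto simp: e_def)
  have \<xi>_meas [measurable]: "\<xi> (Suc i) \<in> borel_measurable M" for i
    using normal[of "Suc i"] by (auto dest: distributed_measurable)
  have \<gamma>_meas [measurable]: "(\<lambda>\<omega>. \<gamma> \<omega> j) \<in> borel_measurable M" for j
  proof -
    have "\<xi> i \<in> borel_measurable M" if "i \<in> {1..j}" for i
      using normal[of i] that by (auto dest: distributed_measurable)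
    then show ?thesis
      unfolding \<gamma>_def unit_coeff_def by (cases "j = 0") (auto intro!: borel_measurable_sum)
  qed
  have [measurable]: "(\<lambda>\<omega>. S \<omega> N) \<in> borel_measurable M" "(\<lambda>\<omega>. A \<omega> N) \<in> borel_measurable M" for N
    unfolding S_def A_def by measurable
  have neq: "AE \<omega> in M. \<forall>j. \<gamma> \<omega> j \<noteq> 0"
    unfolding \<gamma>_def by (intro AE_all_countable[THEN iffD2] allI AE_unit_coeff_neq_0 H indep normal)
  have coeff_neq: "AE \<omega> in M. \<forall>N\<ge>1. \<forall>j. coeff_g H N (\<lambda>i. \<xi> i \<omega>) j \<noteq> 0"
    using neq by eventually_elim
      (auto simp: coeff_g_eq[OF H] \<gamma>_def)
  \<comment> \<open>Bounded second moments against the summable weights (j + 1)^(-1 - e / \<alpha>)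
    give a series with finite expectation.\<close>
  have \<gamma>_summable: "AE \<omega> in M. summable (\<lambda>j. (\<gamma> \<omega> j)\<^sup>2 / real (Suc j) powr (1 + e / \<alpha>))"
  proof -
    obtain C where C: "\<And>j. (\<integral>\<^sup>+\<omega>. ennreal ((\<gamma> \<omega> j)\<^sup>2) \<partial>M) \<le> ennreal C"
      using unit_coeff_second_moment[OF H indep normal] by (auto simp: \<gamma>_def)
    show ?thesis
    proof (rule AE_summable_of_expectation_bounds)
      fix j
      have "(\<integral>\<^sup>+\<omega>. ennreal ((\<gamma> \<omega> j)\<^sup>2 / real (Suc j) powr (1 + e / \<alpha>)) \<partial>M)
          = (\<integral>\<^sup>+\<omega>. ennreal ((\<gamma> \<omega> j)\<^sup>2) \<partial>M) * ennreal (real (Suc j) powr - (1 + e / \<alpha>))"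
        by (simp only: powr_minus_divide, subst nn_integral_multc[symmetric])
          (auto simp: ennreal_mult[symmetric] simp del: of_nat_Suc)
      also have "\<dots> \<le> ennreal (max 0 C) * ennreal (real (Suc j) powr - (1 + e / \<alpha>))"
        using C[of j] by (intro mult_right_mono) (auto elim!: order_trans intro!: ennreal_leI)
      finally show "(\<integral>\<^sup>+\<omega>. ennreal ((\<gamma> \<omega> j)\<^sup>2 / real (Suc j) powr (1 + e / \<alpha>)) \<partial>M)
          \<le> ennreal (max 0 C * real (Suc j) powr - (1 + e / \<alpha>))"
        by (simp add: ennreal_mult del: of_nat_Suc)
      have "summable (\<lambda>k. real k powr - (1 + e / \<alpha>))"
        using e by (simp add: summable_real_powr_iff)
      then show "summable (\<lambda>j. max 0 C * real (Suc j) powr - (1 + e / \<alpha>))"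
        by (intro summable_mult) (rule summable_Suc_iff[THEN iffD2])
    qed (measurable, auto)
  qed
  \<comment> \<open>Each exponential has expectation 1, so the weights 1 / (N + 1)^2 make the series
    summable almost surely. No relation between different N is used, hence \<open>L N\<close> may
    vary with N. The sign s = 1 or s = -1 covers both tails.\<close>
  have exp_summable: "AE \<omega> in M. summable (\<lambda>N. exp (s * L N * S \<omega> N - (L N)\<^sup>2 * A \<omega> N / 2) / (real (Suc N))\<^sup>2)"
    if s: "s\<^sup>2 = 1" for s :: real
  proof (rule AE_summable_of_expectation_bounds)
    fix N
    let ?h = "\<lambda>j x. s * L N / unit_coeff H x j"
    have h_meas: "?h j \<in> borel_measurable (PiM {1..j} (\<lambda>_. borel))" for j
      by (intro borel_measurable_divide borel_measurable_const measurable_unit_coeff)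
    have h_local: "?h j (restrict x {1..j}) = ?h j x" for j x
      by (simp only: unit_coeff_restrict)
    \<comment> \<open>This holds for every \<omega>: where a coefficient vanishes, division by zero
      gives 0 on both sides.\<close>
    have "exp (s * L N * S \<omega> N - (L N)\<^sup>2 * A \<omega> N / 2) =
        exp (\<Sum>j<num_obs \<alpha> N. ?h j (\<lambda>i. \<xi> i \<omega>) * \<xi> (Suc j) \<omega> - (?h j (\<lambda>i. \<xi> i \<omega>))\<^sup>2 / 2)" for \<omega>
      using s by (simp add: S_def A_def \<gamma>_def sum_subtractf sum_distrib_left sum_divide_distrib
          power_divide power_mult_distrib)
    then have "(\<integral>\<^sup>+\<omega>. ennreal (exp (s * L N * S \<omega> N - (L N)\<^sup>2 * A \<omega> N / 2)) \<partial>M) = 1"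
      using nn_integral_exp_predictable_transform[OF indep normal h_meas h_local, of "num_obs \<alpha> N"]
      by (simp only:)
    moreover have "(\<integral>\<^sup>+\<omega>. ennreal (exp (s * L N * S \<omega> N - (L N)\<^sup>2 * A \<omega> N / 2) / (real (Suc N))\<^sup>2) \<partial>M)
        = (\<integral>\<^sup>+\<omega>. ennreal (exp (s * L N * S \<omega> N - (L N)\<^sup>2 * A \<omega> N / 2)) \<partial>M) * ennreal (1 / (real (Suc N))\<^sup>2)"
      unfolding S_def A_def
      by (subst nn_integral_multc[symmetric]) (auto simp: ennreal_mult[symmetric] simp del: of_nat_Suc)
    ultimately show "(\<integral>\<^sup>+\<omega>. ennreal (exp (s * L N * S \<omega> N - (L N)\<^sup>2 * A \<omega> N / 2) / (real (Suc N))\<^sup>2) \<partial>M)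
        \<le> ennreal (1 / (real (Suc N))\<^sup>2)"
      by simp
    show "summable (\<lambda>N. 1 / (real (Suc N))\<^sup>2)"
      using inverse_power_summable[of 2, where 'a = real]
      by (subst summable_Suc_iff[of "\<lambda>n. 1 / (real n)\<^sup>2"]) (simp add: inverse_eq_divide)
    show "(\<lambda>\<omega>. exp (s * L N * S \<omega> N - (L N)\<^sup>2 * A \<omega> N / 2) / (real (Suc N))\<^sup>2) \<in> borel_measurable M"
      by measurable
  qed auto
  have "AE \<omega> in M. summable (\<lambda>N. exp (L N * S \<omega> N - (L N)\<^sup>2 * A \<omega> N / 2) / (real (Suc N))\<^sup>2)"
    and "AE \<omega> in M. summable (\<lambda>N. exp (- L N * S \<omega> N - (L N)\<^sup>2 * A \<omega> N / 2) / (real (Suc N))\<^sup>2)"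
    using exp_summable[of 1] exp_summable[of "- 1"] by simp_all
  with neq \<gamma>_summable
  have "AE \<omega> in M. (\<lambda>N. drift_estimator H \<alpha> N (\<lambda>i. \<xi> i \<omega>) (observation H a N (\<lambda>i. \<xi> i \<omega>))) \<longlonglongrightarrow> a"
  proof eventually_elim
    case (elim \<omega>)
    have "(\<lambda>N. real N powr (1 - H) * S \<omega> N / A \<omega> N) \<longlonglongrightarrow> 0"
      unfolding S_def A_def
      by (rule pathwise_normalised_sum_tendsto_0[OF H(2) \<alpha>])
        (use elim in \<open>simp_all add: S_def A_def L_def e_def\<close>)
    then have "(\<lambda>N. a + real N powr (1 - H) * S \<omega> N / A \<omega> N) \<longlonglongrightarrow> a"
      using tendsto_add[OF tendsto_const[of a]] by fastforce
    \<comment> \<open>The error formula is available from N = 1 on, which suffices for the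
      limit.\<close>
    moreover have "\<forall>\<^sub>F N in sequentially. a + real N powr (1 - H) * S \<omega> N / A \<omega> N =
        drift_estimator H \<alpha> N (\<lambda>i. \<xi> i \<omega>) (observation H a N (\<lambda>i. \<xi> i \<omega>))"
    proof (rule eventually_at_top_linorderI)
      fix N :: nat assume N: "1 \<le> N"
      show "a + real N powr (1 - H) * S \<omega> N / A \<omega> N =
        drift_estimator H \<alpha> N (\<lambda>i. \<xi> i \<omega>) (observation H a N (\<lambda>i. \<xi> i \<omega>))"
        unfolding S_def A_def
        using drift_estimator_error[OF H N \<gamma>_def _ refl num_obs_ge(1)[OF N e(2)]] elim by simp
    qed
    ultimately show ?case
      by (blast intro: Lim_transform_eventually)
  qed
  with coeff_neq show ?thesis
    by blast
qed

end
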